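(* Let $m,n\ge 1$ be integers, let $\sigma\in S_{m+1}$, and let $\pi\in\mathcal{P}_m(n)$ be an $m$-dimensional partition of $n$. Then $\pi$ is $\sigma$-self-symmetric if and only if $W(\delta_\pi,\delta_{\mathrm{sym}_\sigma(\pi)})=0$, where $$W(\delta_\pi,\delta_{\mathrm{sym}_\sigma(\pi)})=\min_{\gamma\in\Pi(\delta_\pi,\delta_{\mathrm{sym}_\sigma(\pi)})}\ \sum_{x\in \mathrm{spt}(\delta_\pi)}\ \sum_{y\in\mathrm{spt}(\delta_{\mathrm{sym}_\sigma(\pi)})}|x-y|^2\,\gamma(x,y).$$
   Context: An $m$-dimensional partition $\pi$ of $n$ is an array of positive integers $n_{i_1,\dots,i_m}$, indexed by positive integers $i_1,\dots,i_m$, which is weakly decreasing in each index $i_j$ and whose entries sum to $n$. The array need not be rectangular: absent entries are regarded as $0$, and the monotonicity is required with this convention. $\mathcal{P}_m(n)$ denotes the set of $m$-dimensional partitions of $n$. The Young diagram of $\pi$ is the union of $n$ unit cubes in $\mathbb{R}^{m+1}$ $$Y(\pi)=\bigcup_{i_1,\dots,i_m}\ \bigcup_{\alpha=1}^{n_{i_1,\dots,i_m}}\Big([\alpha-1,\alpha]\times\prod_{j=1}^m[i_j-1,i_j]\Big),$$ where the first union is over the indices of the array. The probability measure associated with $\pi$ is $$\delta_\pi=\frac1n\sum_{i_1,\dots,i_m}\ \sum_{\alpha=1}^{n_{i_1,\dots,i_m}}\delta(\alpha,i_1,\dots,i_m),$$ where $\delta(x_1,\dots,x_{m+1})$ is the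 Dirac measure at the point $(x_1,\dots,x_{m+1})\in\mathbb{R}^{m+1}$. $\mathrm{spt}$ denotes the support of a measure. For $\sigma\in S_{m+1}$ (the symmetric group on $m+1$ elements), $T_\sigma:\mathbb{R}^{m+1}\to\mathbb{R}^{m+1}$ is the linear map with $e_i\mapsto e_{\sigma(i)}$, where $e_1,\dots,e_{m+1}$ is the standard basis. The $\sigma$-symmetric partition $\mathrm{sym}_\sigma(\pi)\in\mathcal{P}_m(n)$ is the partition whose Young diagram satisfies $Y(\mathrm{sym}_\sigma(\pi))=T_\sigma(Y(\pi))$. The partition $\pi$ is called $\sigma$-self-symmetric if $\pi=\mathrm{sym}_\sigma(\pi)$. $\Pi(\delta_\pi,\delta_{\mathrm{sym}_\sigma(\pi)})$ is the set of transport plans, i.e. nonnegative functions (matrices) $\gamma$ on $\mathrm{spt}(\delta_\pi)\times\mathrm{spt}(\delta_{\mathrm{sym}_\sigma(\pi)})$ with $\sum_y\gamma(x,y)=\delta_\pi(\{x\})$ for all $x$ and $\sum_x\gamma(x,y)=\delta_{\mathrm{sym}_\sigma(\pi)}(\{y\})$ for all $y$. $|\cdot|$ is the Euclidean norm. *)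

theory Defs
  imports "HOL-Probability.Probability"
begin

(* The m array directions are the elements of a finite type 'm, so m = CARD('m) \<ge> 1.
   Ambient space R^(m+1) is real ^ 'm option: coordinate None is the height (the first
   coordinate), coordinate Some j is the one of the index i_j. *)

text \<open>
  An array is a function on multi-indices with value 0 at absent entries. Multi-indices are
  1-based: those with a zero component are not indices at all, and \<open>partitions\<close> forces
  the value 0 there, so that equality of partitions is equality of functions.
\<close>

type_synonym 'm array = "('m \<Rightarrow> nat) \<Rightarrow> nat"

definition indices :: "'m array \<Rightarrow> ('m \<Rightarrow> nat) set" where
  "indices \<pi> = {i. \<pi> i > 0}"

definition partitions :: "nat \<Rightarrow> ('m::finite) array set" where
  "partitions n = {\<pi>.
     finite (indices \<pi>) \<and>
     (\<forall>i\<in>indices \<pi>. \<forall>j. 1 \<le> i j) \<and>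
     (\<forall>i j k. (\<forall>l. 1 \<le> i l) \<and> i j \<le> k \<longrightarrow> \<pi> (i(j := k)) \<le> \<pi> i) \<and>
     (\<Sum>i\<in>indices \<pi>. \<pi> i) = n}"

definition unit_cube :: "nat \<Rightarrow> ('m::finite \<Rightarrow> nat) \<Rightarrow> (real ^ 'm option) set" where
  "unit_cube \<alpha> i = {x. x $ None \<in> {real \<alpha> - 1..real \<alpha>} \<and>
                       (\<forall>j. x $ Some j \<in> {real (i j) - 1..real (i j)})}"

definition young_diagram :: "('m::finite) array \<Rightarrow> (real ^ 'm option) set" where
  "young_diagram \<pi> = (\<Union>i\<in>indices \<pi>. \<Union>\<alpha>\<in>{1..\<pi> i}. unit_cube \<alpha> i)"

definition lattice_point :: "nat \<Rightarrow> ('m::finite \<Rightarrow> nat) \<Rightarrow> real ^ 'm option" where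
  "lattice_point \<alpha> i = (\<chi> k. case k of None \<Rightarrow> real \<alpha> | Some j \<Rightarrow> real (i j))"

text \<open>Wherever \<open>n\<close> occurs below as a parameter, it is meant to be the sum of the entries of \<open>\<pi>\<close>.\<close>

definition partition_measure :: "nat \<Rightarrow> ('m::finite) array \<Rightarrow> (real ^ 'm option) measure" where
  "partition_measure n \<pi> = measure_of UNIV (sets borel)
     (\<lambda>A. ennreal (1 / real n) *
           (\<Sum>i\<in>indices \<pi>. \<Sum>\<alpha>=1..\<pi> i. emeasure (return borel (lattice_point \<alpha> i)) A))"

definition perm_map :: "('k \<Rightarrow> 'k) \<Rightarrow> real ^ 'k \<Rightarrow> real ^ ('k::finite)" where
  "perm_map \<sigma> x = (\<Sum>k\<in>UNIV. (x $ k) *\<^sub>R axis (\<sigma> k) 1)"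

definition sym_partition ::
    "nat \<Rightarrow> ('m option \<Rightarrow> 'm option) \<Rightarrow> ('m::finite) array \<Rightarrow> 'm array" where
  "sym_partition n \<sigma> \<pi> =
     (THE \<rho>. \<rho> \<in> partitions n \<and> young_diagram \<rho> = perm_map \<sigma> ` young_diagram \<pi>)"

definition self_symmetric ::
    "nat \<Rightarrow> ('m option \<Rightarrow> 'm option) \<Rightarrow> ('m::finite) array \<Rightarrow> bool" where
  "self_symmetric n \<sigma> \<pi> \<longleftrightarrow> \<pi> = sym_partition n \<sigma> \<pi>"

definition spt :: "'a::topological_space measure \<Rightarrow> 'a set" where
  "spt \<mu> = {x. \<forall>U. open U \<and> x \<in> U \<longrightarrow> emeasure \<mu> U > 0}"

text \<open>
  The following two definitions are for measures of finite support. A plan is a total function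
  of which only the values on the product of the supports matter.
\<close>

definition transport_plans ::
    "'a::topological_space measure \<Rightarrow> 'a measure \<Rightarrow> ('a \<Rightarrow> 'a \<Rightarrow> real) set" where
  "transport_plans \<mu> \<nu> = {\<gamma>.
     (\<forall>x\<in>spt \<mu>. \<forall>y\<in>spt \<nu>. 0 \<le> \<gamma> x y) \<and>
     (\<forall>x\<in>spt \<mu>. (\<Sum>y\<in>spt \<nu>. \<gamma> x y) = measure \<mu> {x}) \<and>
     (\<forall>y\<in>spt \<nu>. (\<Sum>x\<in>spt \<mu>. \<gamma> x y) = measure \<nu> {y})}"

definition transport_cost ::
    "'a::real_normed_vector measure \<Rightarrow> 'a measure \<Rightarrow> ('a \<Rightarrow> 'a \<Rightarrow> real) \<Rightarrow> real" where
  "transport_cost \<mu> \<nu> \<gamma> = (\<Sum>x\<in>spt \<mu>. \<Sum>y\<in>spt \<nu>. (norm (x - y))\<^sup>2 * \<gamma> x y)"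

text \<open>\<open>LEAST\<close> renders the minimum over an infinite set: it is the value attained by an optimal
  plan, not merely an infimum.\<close>

definition W :: "'a::real_normed_vector measure \<Rightarrow> 'a measure \<Rightarrow> real" where
  "W \<mu> \<nu> = (LEAST c. c \<in> transport_cost \<mu> \<nu> ` transport_plans \<mu> \<nu>)"

end

theory Submission
  imports Defs
begin

text \<open>
  A partition \<open>\<pi>\<close> is recovered from the finite set of lattice points that carries its measure: for
  \<open>\<alpha> \<ge> 1\<close> the point \<open>(\<alpha>, i)\<close> belongs to that set exactly when \<open>\<alpha> \<le> \<pi> i\<close>. All these points have the
  same mass \<open>1 / n\<close>, so two partitions of \<open>n\<close> are equal as soon as their measures have the same
  support. If some plan between the two measures has cost zero, it moves no mass over a positive
  distance; since it empties every point of the first support and fills every point of the second,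
  the supports agree. Conversely the diagonal plan from a measure to itself costs nothing. These
  arguments give the equivalence once two existence questions are settled.

  The first is that \<open>W\<close> is an attained minimum (\<open>optimal_plan_exists\<close>), so that \<open>W = 0\<close> yields a plan
  of cost zero: the plans form a compact set of functions, the cost is continuous, and the product
  plan shows that the set is not empty.

  The second is that the symmetric partition exists and is unique
  (\<open>sym_partition_in_partitions\<close>). To see this, a partition is encoded as its set \<open>cells \<pi>\<close> of
  lattice points, a finite subset of the functions \<open>'m option \<Rightarrow> nat\<close> with positive values that is
  closed under decreasing one coordinate. In this description the height has no privileged role,
  hence permuting the coordinates preserves it, and every such set with \<open>n\<close> elements comes from a
  unique partition of \<open>n\<close>. The Young diagram determines the set of cells because the centre of a
  unit cube lies in no other unit cube of the lattice.
\<close>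

section \<open>Partitions as finite sets of cells\<close>

definition cells :: "'m array \<Rightarrow> ('m option \<Rightarrow> nat) set" where
  "cells \<pi> = {c. 1 \<le> c None \<and> c None \<le> \<pi> (c \<circ> Some)}"

text \<open>
  Closure is required only for changes of a single coordinate, as in the definition of
  \<open>partitions\<close>; this form is visibly invariant under permutations of the coordinates.
\<close>

definition is_diagram :: "('k \<Rightarrow> nat) set \<Rightarrow> bool" where
  "is_diagram D \<longleftrightarrow> finite D \<and> (\<forall>c\<in>D. \<forall>k. 1 \<le> c k) \<and>
     (\<forall>c\<in>D. \<forall>k v. 1 \<le> v \<and> v \<le> c k \<longrightarrow> c(k := v) \<in> D)"

definition cell_point :: "('k::finite \<Rightarrow> nat) \<Rightarrow> real ^ 'k" where
  "cell_point c = (\<chi> k. real (c k))"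

definition cell_cube :: "('k::finite \<Rightarrow> nat) \<Rightarrow> (real ^ 'k) set" where
  "cell_cube c = {x. \<forall>k. x $ k \<in> {real (c k) - 1..real (c k)}}"

lemma case_option_eta: "case_option (c None) (c \<circ> Some) = c"
  by (auto simp: fun_eq_iff split: option.splits)

lemma case_option_comp_Some [simp]: "case_option a i \<circ> Some = i"
  by (auto simp: fun_eq_iff)

lemma case_option_in_cells: "case_option a i \<in> cells \<pi> \<longleftrightarrow> 1 \<le> a \<and> a \<le> \<pi> i"
  by (simp add: cells_def)

lemma cells_inject: "cells \<pi> = cells \<rho> \<Longrightarrow> \<pi> = \<rho>"
proof
  fix i assume eq: "cells \<pi> = cells \<rho>"
  have *: "1 \<le> a \<and> a \<le> \<pi> i \<longleftrightarrow> 1 \<le> a \<and> a \<le> \<rho> i" for a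
    using eq case_option_in_cells[of a i] by metis
  show "\<pi> i = \<rho> i"
    using *[of "\<pi> i"] *[of "\<rho> i"] by linarith
qed

lemma bij_betw_cells:
  "bij_betw (\<lambda>(i, \<alpha>). case_option \<alpha> i) (SIGMA i:indices \<pi>. {1..\<pi> i}) (cells \<pi>)"
proof (rule bij_betw_byWitness[where f' = "\<lambda>c. (c \<circ> Some, c None)"])
  show "\<forall>c\<in>cells \<pi>. (\<lambda>(i, \<alpha>). case_option \<alpha> i) (c \<circ> Some, c None) = c"
    by (simp add: case_option_eta)
qed (auto simp: cells_def indices_def)

lemma finite_cells: "finite (indices \<pi>) \<Longrightarrow> finite (cells \<pi>)"
  using bij_betw_finite[OF bij_betw_cells[of \<pi>]] by auto

lemma sum_cells:
  assumes "finite (indices \<pi>)"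
  shows "(\<Sum>i\<in>indices \<pi>. \<Sum>\<alpha>=1..\<pi> i. f (case_option \<alpha> i)) = (\<Sum>c\<in>cells \<pi>. f c)"
proof -
  have "(\<Sum>i\<in>indices \<pi>. \<Sum>\<alpha>=1..\<pi> i. f (case_option \<alpha> i))
      = (\<Sum>p\<in>(SIGMA i:indices \<pi>. {1..\<pi> i}). f ((\<lambda>(i, \<alpha>). case_option \<alpha> i) p))"
    using assms by (subst sum.Sigma) (auto intro!: sum.cong)
  also have "\<dots> = (\<Sum>c\<in>cells \<pi>. f c)"
    by (rule sum.reindex_bij_betw[OF bij_betw_cells])
  finally show ?thesis .
qed

lemma card_cells: "finite (indices \<pi>) \<Longrightarrow> card (cells \<pi>) = (\<Sum>i\<in>indices \<pi>. \<pi> i)"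
  using sum_cells[of \<pi> "\<lambda>_. 1::nat"] by simp

lemma is_diagram_cells:
  assumes "\<pi> \<in> partitions n"
  shows "is_diagram (cells \<pi>)" and "card (cells \<pi>) = n"
proof -
  have fin: "finite (indices \<pi>)" and pos: "\<And>i j. \<pi> i > 0 \<Longrightarrow> 1 \<le> i j"
    and mono: "\<And>i j k. (\<forall>l. 1 \<le> i l) \<Longrightarrow> i j \<le> k \<Longrightarrow> \<pi> (i(j := k)) \<le> \<pi> i"
    using assms by (auto simp: partitions_def indices_def)
  show "card (cells \<pi>) = n"
    using assms card_cells[OF fin] by (simp add: partitions_def)
  have pos': "1 \<le> c k" if "c \<in> cells \<pi>" for c k
    using that pos[of "c \<circ> Some"] by (cases k) (fastforce simp: cells_def)+
  have "c(k := v) \<in> cells \<pi>" if c: "c \<in> cells \<pi>" and v: "1 \<le> v" "v \<le> c k" for c k v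
  proof (cases k)
    case None
    have "c(None := v) \<circ> Some = c \<circ> Some"
      by (simp add: fun_eq_iff)
    then show ?thesis
      using c v None by (auto simp: cells_def)
  next
    case (Some j)
    let ?i = "(c \<circ> Some)(j := v)"
    have upd: "c(Some j := v) \<circ> Some = ?i"
      by (simp add: fun_eq_iff)
    have "\<pi> (?i(j := c k)) \<le> \<pi> ?i"
      using pos'[OF c] v Some by (intro mono) auto
    moreover have "?i(j := c k) = c \<circ> Some"
      using Some by (auto simp: fun_eq_iff)
    ultimately show ?thesis
      using c Some upd by (auto simp: cells_def)
  qed
  then show "is_diagram (cells \<pi>)"
    using finite_cells[OF fin] pos' by (auto simp: is_diagram_def)
qed

text \<open>
  Over a fixed multi-index the heights in a diagram form an initial segment of the positive
  integers, so the entry is the number of these heights.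
\<close>

lemma is_diagram_imp_cells:
  fixes D :: "('m::finite option \<Rightarrow> nat) set"
  assumes D: "is_diagram D"
  shows "\<exists>\<rho>\<in>partitions (card D). cells \<rho> = D"
proof -
  define H where "H i = {a. case_option a i \<in> D}" for i
  define \<rho> where "\<rho> i = card (H i)" for i
  have fin: "finite D" and pos: "\<And>c k. c \<in> D \<Longrightarrow> 1 \<le> c k"
    and down: "\<And>c k v. c \<in> D \<Longrightarrow> 1 \<le> v \<Longrightarrow> v \<le> c k \<Longrightarrow> c(k := v) \<in> D"
    using D by (auto simp: is_diagram_def)
  have H_pos: "1 \<le> a" if "a \<in> H i" for a i
    using pos[of "case_option a i" None] that by (simp add: H_def)
  have H_down: "b \<in> H i" if "a \<in> H i" "1 \<le> b" "b \<le> a" for a b i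
  proof -
    have "(case_option a i)(None := b) = case_option b i"
      by (auto simp: fun_eq_iff split: option.splits)
    then show ?thesis
      using down[of "case_option a i" b None] that by (simp add: H_def)
  qed
  have H_fin: "finite (H i)" for i
  proof (rule finite_subset)
    show "H i \<subseteq> (\<lambda>c. c None) ` D"
    proof
      fix a assume "a \<in> H i"
      then show "a \<in> (\<lambda>c. c None) ` D"
        by (intro image_eqI[of _ _ "case_option a i"]) (simp_all add: H_def)
    qed
  qed (use fin in simp)
  have H_eq: "H i = {1..\<rho> i}" for i
  proof (cases "H i = {}")
    case False
    have "H i = {1..Max (H i)}"
      using H_pos Max_ge[OF H_fin] H_down[OF Max_in[OF H_fin False]] by fastforce
    then have "\<rho> i = Max (H i)"
      using \<rho>_def by (metis card_atLeastAtMost diff_Suc_1)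
    then show ?thesis
      using \<open>H i = {1..Max (H i)}\<close> by simp
  qed (simp add: \<rho>_def)
  have cells: "cells \<rho> = D"
  proof (rule set_eqI)
    fix c
    have "c \<in> cells \<rho> \<longleftrightarrow> c None \<in> H (c \<circ> Some)"
      using H_eq[of "c \<circ> Some"] by (auto simp: cells_def)
    then show "c \<in> cells \<rho> \<longleftrightarrow> c \<in> D"
      by (simp add: H_def case_option_eta)
  qed
  have top: "case_option (\<rho> i) i \<in> D" if "\<rho> i > 0" for i
    using that cells case_option_in_cells[of "\<rho> i" i \<rho>] by auto
  have ind_fin: "finite (indices \<rho>)"
  proof (rule finite_subset)
    show "indices \<rho> \<subseteq> (\<lambda>c. c \<circ> Some) ` D"
    proof
      fix i assume "i \<in> indices \<rho>"
      then show "i \<in> (\<lambda>c. c \<circ> Some) ` D"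
        using top by (intro image_eqI[of _ _ "case_option (\<rho> i) i"]) (simp_all add: indices_def)
    qed
  qed (use fin in simp)
  have ind_pos: "1 \<le> i j" if "\<rho> i > 0" for i j
    using pos[OF top[OF that], of "Some j"] by simp
  have mono: "\<rho> (i(j := k)) \<le> \<rho> i" if i: "\<forall>l. 1 \<le> i l" "i j \<le> k" for i j k
  proof (cases "\<rho> (i(j := k)) = 0")
    case False
    let ?c = "case_option (\<rho> (i(j := k))) (i(j := k))"
    have "?c(Some j := i j) \<in> D"
      using False i top[of "i(j := k)"] by (intro down) auto
    also have "?c(Some j := i j) = case_option (\<rho> (i(j := k))) i"
      by (auto simp: fun_eq_iff split: option.splits)
    finally show ?thesis
      using cells case_option_in_cells[of _ i \<rho>] by auto
  qed simp
  have "\<rho> \<in> partitions (card D)"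
    using ind_fin ind_pos mono card_cells[OF ind_fin] cells
    by (auto simp: partitions_def indices_def)
  with cells show ?thesis
    by blast
qed

section \<open>Young diagrams and the symmetric partition\<close>

lemma young_diagram_eq_cells: "young_diagram \<pi> = (\<Union>c\<in>cells \<pi>. cell_cube c)"
proof -
  have cube: "unit_cube \<alpha> i = cell_cube (case_option \<alpha> i)" for \<alpha> and i :: "'a \<Rightarrow> nat"
    by (auto simp: unit_cube_def cell_cube_def split: option.splits)
  have "(\<Union>c\<in>cells \<pi>. cell_cube c)
      = (\<Union>p\<in>(SIGMA i:indices \<pi>. {1..\<pi> i}). cell_cube ((\<lambda>(i, \<alpha>). case_option \<alpha> i) p))"
    by (simp add: bij_betw_imp_surj_on[OF bij_betw_cells, symmetric] image_image)
  also have "\<dots> = young_diagram \<pi>"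
    by (auto simp: young_diagram_def cube)
  finally show ?thesis
    by simp
qed

text \<open>
  Neighbouring closed cubes share faces, so an arbitrary point of a cube does not identify its
  cell. The centre does, because its coordinates are half-integers; this is how a union of cubes
  remembers the cells.
\<close>

lemma centre_in_cell_cube:
  "(\<chi> k. real (c k) - 1 / 2) \<in> cell_cube d \<longleftrightarrow> c = d"
proof
  assume "(\<chi> k. real (c k) - 1 / 2) \<in> cell_cube d"
  then have "real (d k) - 1 \<le> real (c k) - 1 / 2 \<and> real (c k) - 1 / 2 \<le> real (d k)" for k
    by (simp add: cell_cube_def)
  then have "real (d k) < real (c k + 1) \<and> real (c k) < real (d k + 1)" for k
    by (smt (verit) field_sum_of_halves of_nat_1 of_nat_add)
  then have "c k = d k" for k
    unfolding of_nat_less_iff by (metis Suc_eq_plus1 less_Suc_eq_le le_antisym)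
  then show "c = d" ..
qed (simp add: cell_cube_def)

lemma cell_cubes_inject:
  fixes C D :: "('k::finite \<Rightarrow> nat) set"
  assumes "(\<Union>c\<in>C. cell_cube c) = (\<Union>c\<in>D. cell_cube c)"
  shows "C = D"
proof (rule set_eqI)
  fix c :: "'k \<Rightarrow> nat"
  have centre: "(\<chi> k. real (c k) - 1 / 2) \<in> (\<Union>c\<in>E. cell_cube c) \<longleftrightarrow> c \<in> E" for E
    by (simp add: centre_in_cell_cube)
  show "c \<in> C \<longleftrightarrow> c \<in> D"
    using centre[of C] centre[of D] assms by simp
qed

lemma perm_map_nth:
  assumes "\<sigma> permutes UNIV"
  shows "perm_map \<sigma> x $ k = x $ inv \<sigma> k"
proof -
  have "k = \<sigma> l \<longleftrightarrow> l = inv \<sigma> k" for l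
    using permutes_inverses[OF assms] by metis
  then have "x $ l * axis (\<sigma> l) 1 $ k = (if l = inv \<sigma> k then x $ l else 0)" for l
    unfolding axis_def by simp
  then have "perm_map \<sigma> x $ k = (\<Sum>l\<in>UNIV. if l = inv \<sigma> k then x $ l else 0)"
    unfolding perm_map_def by simp
  then show ?thesis
    by simp
qed

lemma perm_map_cell_cube:
  assumes "\<sigma> permutes UNIV"
  shows "perm_map \<sigma> ` cell_cube c = cell_cube (c \<circ> inv \<sigma>)"
proof (intro equalityI subsetI)
  fix y assume y: "y \<in> cell_cube (c \<circ> inv \<sigma>)"
  have "y = perm_map \<sigma> (\<chi> k. y $ \<sigma> k)"
    by (simp add: vec_eq_iff perm_map_nth[OF assms] permutes_inverses[OF assms])
  moreover have "(\<chi> k. y $ \<sigma> k) \<in> cell_cube c"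
    unfolding cell_cube_def
  proof (intro CollectI allI)
    fix k
    have "y $ \<sigma> k \<in> {real ((c \<circ> inv \<sigma>) (\<sigma> k)) - 1..real ((c \<circ> inv \<sigma>) (\<sigma> k))}"
      using y unfolding cell_cube_def by blast
    then show "(\<chi> k. y $ \<sigma> k) $ k \<in> {real (c k) - 1..real (c k)}"
      by (simp add: permutes_inverses[OF assms])
  qed
  ultimately show "y \<in> perm_map \<sigma> ` cell_cube c"
    by blast
qed (auto simp: cell_cube_def perm_map_nth[OF assms])

lemma is_diagram_permute:
  assumes D: "is_diagram D" and \<sigma>: "\<sigma> permutes UNIV"
  shows "is_diagram ((\<lambda>c. c \<circ> inv \<sigma>) ` D)"
proof -
  have "(c \<circ> inv \<sigma>)(k := v) \<in> (\<lambda>c. c \<circ> inv \<sigma>) ` D"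
    if "c \<in> D" "1 \<le> v" "v \<le> c (inv \<sigma> k)" for c k v
  proof (rule image_eqI)
    show "(c \<circ> inv \<sigma>)(k := v) = c(inv \<sigma> k := v) \<circ> inv \<sigma>"
      using permutes_inverses(1)[OF \<sigma>] by (auto simp: fun_eq_iff) metis
    show "c(inv \<sigma> k := v) \<in> D"
      using D that by (auto simp: is_diagram_def)
  qed
  then show ?thesis
    using D by (auto simp: is_diagram_def)
qed

lemma card_permute:
  assumes "\<sigma> permutes UNIV"
  shows "card ((\<lambda>c. c \<circ> inv \<sigma>) ` D) = card D"
proof (intro card_image inj_onI)
  fix c d assume "c \<circ> inv \<sigma> = d \<circ> inv \<sigma>"
  then have "(c \<circ> inv \<sigma>) (\<sigma> k) = (d \<circ> inv \<sigma>) (\<sigma> k)" for k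
    by simp
  then show "c = d"
    by (simp add: permutes_inverses[OF assms] fun_eq_iff)
qed

text \<open>
  The permuted cells form a diagram with \<open>n\<close> elements, hence the cells of a partition. Injectivity
  of both encodings, by cells and by unions of cubes, makes the definite description unique.
\<close>

lemma sym_partition_in_partitions:
  fixes \<sigma> :: "'m::finite option \<Rightarrow> 'm option"
  assumes \<sigma>: "\<sigma> permutes UNIV" and \<pi>: "\<pi> \<in> partitions n"
  shows "sym_partition n \<sigma> \<pi> \<in> partitions n"
proof -
  let ?D = "(\<lambda>c. c \<circ> inv \<sigma>) ` cells \<pi>"
  have "is_diagram ?D" and "card ?D = n"
    using is_diagram_permute[OF is_diagram_cells(1)[OF \<pi>] \<sigma>] card_permute[OF \<sigma>]
      is_diagram_cells(2)[OF \<pi>] by auto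
  then obtain \<rho> where \<rho>: "\<rho> \<in> partitions n" "cells \<rho> = ?D"
    using is_diagram_imp_cells by blast
  have image: "perm_map \<sigma> ` young_diagram \<pi> = (\<Union>c\<in>?D. cell_cube c)"
    by (simp add: young_diagram_eq_cells image_UN perm_map_cell_cube[OF \<sigma>])
  have "\<exists>!\<rho>. \<rho> \<in> partitions n \<and> young_diagram \<rho> = perm_map \<sigma> ` young_diagram \<pi>"
  proof (rule ex1I)
    show "\<rho> \<in> partitions n \<and> young_diagram \<rho> = perm_map \<sigma> ` young_diagram \<pi>"
      using \<rho> image by (simp add: young_diagram_eq_cells)
    show "\<tau> = \<rho>" if "\<tau> \<in> partitions n \<and> young_diagram \<tau> = perm_map \<sigma> ` young_diagram \<pi>" for \<tau>
    proof (rule cells_inject, rule cell_cubes_inject)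
      show "(\<Union>c\<in>cells \<tau>. cell_cube c) = (\<Union>c\<in>cells \<rho>. cell_cube c)"
        using that \<rho>(2) image by (simp add: young_diagram_eq_cells)
    qed
  qed
  from theI'[OF this] show ?thesis
    by (simp add: sym_partition_def)
qed

section \<open>The measure of a partition\<close>

lemma inj_cell_point: "inj cell_point"
  by (auto simp: inj_def cell_point_def vec_eq_iff)

lemma emeasure_partition_measure:
  assumes fin: "finite (indices \<pi>)" and A: "A \<in> sets borel"
  shows "emeasure (partition_measure n \<pi>) A
    = ennreal (1 / real n) * of_nat (card (cell_point ` cells \<pi> \<inter> A))"
proof -
  let ?f = "\<lambda>A. ennreal (1 / real n) * (\<Sum>c\<in>cells \<pi>. emeasure (return borel (cell_point c)) A)"
  have lattice: "lattice_point \<alpha> i = cell_point (case_option \<alpha> i)" for \<alpha> and i :: "'a \<Rightarrow> nat"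
    by (auto simp: lattice_point_def cell_point_def vec_eq_iff split: option.splits)
  have M: "partition_measure n \<pi> = measure_of UNIV (sets borel) ?f"
    unfolding partition_measure_def lattice
    using sum_cells[OF fin, of "\<lambda>c. emeasure (return borel (cell_point c)) _"] by simp
  \<comment> \<open>Without countable additivity \<open>measure_of\<close> would yield the null measure.\<close>
  have "countably_additive (sets borel) ?f"
  proof (rule countably_additiveI)
    fix B :: "nat \<Rightarrow> (real ^ 'a option) set"
    assume B: "range B \<subseteq> sets borel" "disjoint_family B"
    have "(\<Sum>j. ?f (B j)) = ennreal (1 / real n) *
        (\<Sum>c\<in>cells \<pi>. \<Sum>j. emeasure (return borel (cell_point c)) (B j))"
      by (simp add: ennreal_suminf_cmult suminf_sum)
    also have "\<dots> = ?f (\<Union>(range B))"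
      using B by (subst suminf_emeasure) auto
    finally show "(\<Sum>j. ?f (B j)) = ?f (\<Union>(range B))" .
  qed
  then have "emeasure (partition_measure n \<pi>) A = ?f A"
    using A unfolding M
    by (intro emeasure_measure_of_sigma) (auto simp: positive_def intro: sets.sigma_algebra_axioms[of borel, simplified])
  also have "(\<Sum>c\<in>cells \<pi>. emeasure (return borel (cell_point c)) A)
      = (\<Sum>x\<in>cell_point ` cells \<pi>. indicator A x)"
    using A by (simp add: sum.reindex inj_on_subset[OF inj_cell_point])
  also have "\<dots> = of_nat (card (cell_point ` cells \<pi> \<inter> A))"
    using sum_of_bool_eq[of "cell_point ` cells \<pi>" "\<lambda>x. x \<in> A"] finite_cells[OF fin]
    by (simp add: indicator_def of_bool_def Int_def)
  finally show ?thesis .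
qed

lemma spt_partition_measure:
  assumes fin: "finite (indices \<pi>)" and n: "n \<ge> 1"
  shows "spt (partition_measure n \<pi>) = cell_point ` cells \<pi>"
proof -
  let ?L = "cell_point ` cells \<pi>"
  have L: "finite ?L"
    using finite_cells[OF fin] by simp
  have pos: "emeasure (partition_measure n \<pi>) U > 0 \<longleftrightarrow> ?L \<inter> U \<noteq> {}" if "open U" for U
    using that n L
    by (simp add: emeasure_partition_measure[OF fin] ennreal_zero_less_mult_iff card_gt_0_iff)
  have "open (- ?L)"
    using finite_imp_closed[OF L] by (rule open_Compl)
  then show ?thesis
    using pos by (fastforce simp: spt_def)
qed

lemma measure_partition_measure_singleton:
  assumes fin: "finite (indices \<pi>)" and "x \<in> cell_point ` cells \<pi>"
  shows "measure (partition_measure n \<pi>) {x} = 1 / real n"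
  using assms by (simp add: measure_def emeasure_partition_measure[OF fin])

section \<open>Optimal transport between finitely supported measures\<close>

lemma transport_cost_nonneg:
  "\<gamma> \<in> transport_plans \<mu> \<nu> \<Longrightarrow> 0 \<le> transport_cost \<mu> \<nu> \<gamma>"
  by (auto simp: transport_cost_def transport_plans_def intro!: sum_nonneg)

text \<open>
  Plans that vanish off the product of the supports form a closed subset of a product of compact
  intervals, since no entry exceeds the mass of its row; by Tychonoff this set is compact.
\<close>

lemma optimal_plan_exists:
  fixes \<mu> \<nu> :: "'a::real_normed_vector measure"
  assumes fin: "finite (spt \<mu>)" "finite (spt \<nu>)" and ne: "transport_plans \<mu> \<nu> \<noteq> {}"
  shows "\<exists>\<gamma>\<in>transport_plans \<mu> \<nu>. \<forall>\<gamma>'\<in>transport_plans \<mu> \<nu>.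
    transport_cost \<mu> \<nu> \<gamma> \<le> transport_cost \<mu> \<nu> \<gamma>'"
proof -
  let ?A = "spt \<mu>" and ?B = "spt \<nu>"
  define K where "K = (\<Pi>\<^sub>E p\<in>UNIV. if p \<in> ?A \<times> ?B then {0..measure \<mu> {fst p}} else {0::real})"
  define R where "R = (\<Inter>x\<in>?A. {f :: 'a \<times> 'a \<Rightarrow> real. (\<Sum>y\<in>?B. f (x, y)) = measure \<mu> {x}})"
  define C where "C = (\<Inter>y\<in>?B. {f :: 'a \<times> 'a \<Rightarrow> real. (\<Sum>x\<in>?A. f (x, y)) = measure \<nu> {y}})"
  have coord: "continuous_on S (\<lambda>f :: 'a \<times> 'a \<Rightarrow> real. f p)" for S p
    by (rule continuous_on_subset[OF continuous_on_product_coordinates]) simp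
  have "compact K"
    unfolding K_def
    by (subst compactin_euclidean_iff[symmetric], subst euclidean_product_topology[symmetric],
        subst compactin_PiE) simp
  moreover have "closed R" "closed C"
    unfolding R_def C_def
    by (intro closed_INT ballI closed_Collect_eq continuous_on_sum continuous_on_const coord)+
  ultimately have compact: "compact (K \<inter> R \<inter> C)"
    by (simp only: compact_Int_closed)
  have curry_plan: "curry f \<in> transport_plans \<mu> \<nu>" if "f \<in> K \<inter> R \<inter> C" for f
  proof -
    have "f p \<in> (if p \<in> ?A \<times> ?B then {0..measure \<mu> {fst p}} else {0})" for p
      using that unfolding K_def by (intro PiE_mem[of f UNIV]) auto
    then have "0 \<le> f (x, y)" if "x \<in> ?A" "y \<in> ?B" for x y
      using that by (metis SigmaI atLeastAtMost_iff)
    then show ?thesis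
      using that by (auto simp: transport_plans_def R_def C_def)
  qed
  have restrict_plan: "\<exists>f\<in>K \<inter> R \<inter> C. transport_cost \<mu> \<nu> (curry f) = transport_cost \<mu> \<nu> \<gamma>"
    if \<gamma>: "\<gamma> \<in> transport_plans \<mu> \<nu>" for \<gamma>
  proof
    let ?f = "\<lambda>p. if p \<in> ?A \<times> ?B then \<gamma> (fst p) (snd p) else 0"
    have "\<gamma> x y \<le> measure \<mu> {x}" if "x \<in> ?A" "y \<in> ?B" for x y
      using \<gamma> that member_le_sum[of y ?B "\<gamma> x"] fin by (auto simp: transport_plans_def)
    then show "?f \<in> K \<inter> R \<inter> C"
      using \<gamma> by (auto simp: K_def R_def C_def transport_plans_def)
    show "transport_cost \<mu> \<nu> (curry ?f) = transport_cost \<mu> \<nu> \<gamma>"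
      by (simp add: transport_cost_def)
  qed
  have "K \<inter> R \<inter> C \<noteq> {}"
    using ne restrict_plan by blast
  moreover have "continuous_on (K \<inter> R \<inter> C) (\<lambda>f. transport_cost \<mu> \<nu> (curry f))"
    unfolding transport_cost_def curry_def
    by (intro continuous_on_sum continuous_on_mult continuous_on_const coord)
  ultimately obtain f where f: "f \<in> K \<inter> R \<inter> C"
    and least: "\<forall>g\<in>K \<inter> R \<inter> C. transport_cost \<mu> \<nu> (curry f) \<le> transport_cost \<mu> \<nu> (curry g)"
    using continuous_attains_inf[OF compact] by blast
  have "transport_cost \<mu> \<nu> (curry f) \<le> transport_cost \<mu> \<nu> \<gamma>"
    if "\<gamma> \<in> transport_plans \<mu> \<nu>" for \<gamma>
    using restrict_plan[OF that] least by metis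
  then show ?thesis
    using curry_plan[OF f] by blast
qed

lemma W_attained:
  fixes \<mu> \<nu> :: "'a::real_normed_vector measure"
  assumes "finite (spt \<mu>)" "finite (spt \<nu>)" "transport_plans \<mu> \<nu> \<noteq> {}"
  obtains \<gamma> where "\<gamma> \<in> transport_plans \<mu> \<nu>" "transport_cost \<mu> \<nu> \<gamma> = W \<mu> \<nu>"
proof -
  obtain \<gamma> where \<gamma>: "\<gamma> \<in> transport_plans \<mu> \<nu>"
    "\<forall>\<gamma>'\<in>transport_plans \<mu> \<nu>. transport_cost \<mu> \<nu> \<gamma> \<le> transport_cost \<mu> \<nu> \<gamma>'"
    using optimal_plan_exists[OF assms] by blast
  then have "W \<mu> \<nu> = transport_cost \<mu> \<nu> \<gamma>"
    unfolding W_def by (intro Least_equality) auto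
  with \<gamma>(1) that show ?thesis
    by simp
qed

lemma W_self:
  fixes \<mu> :: "'a::real_normed_vector measure"
  assumes "finite (spt \<mu>)"
  shows "W \<mu> \<mu> = 0"
  unfolding W_def
proof (rule Least_equality)
  let ?\<gamma> = "\<lambda>x y. if x = y then measure \<mu> {x} else 0"
  have "?\<gamma> \<in> transport_plans \<mu> \<mu>"
    using assms by (auto simp: transport_plans_def)
  moreover have "transport_cost \<mu> \<mu> ?\<gamma> = 0"
    by (auto simp: transport_cost_def intro!: sum.neutral)
  ultimately show "0 \<in> transport_cost \<mu> \<mu> ` transport_plans \<mu> \<mu>"
    by (intro image_eqI[of _ _ ?\<gamma>]) simp_all
qed (auto intro: transport_cost_nonneg)

text \<open>
  Used to see that the set of plans is not empty. Row sums of the product carry the total mass of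
  \<open>\<nu>\<close> as a factor, and column sums that of \<open>\<mu>\<close>; hence both masses are required to be \<open>1\<close>.
\<close>

lemma product_plan:
  assumes "(\<Sum>x\<in>spt \<mu>. measure \<mu> {x}) = 1" "(\<Sum>y\<in>spt \<nu>. measure \<nu> {y}) = 1"
  shows "(\<lambda>x y. measure \<mu> {x} * measure \<nu> {y}) \<in> transport_plans \<mu> \<nu>"
proof -
  have "(\<Sum>y\<in>spt \<nu>. measure \<mu> {x} * measure \<nu> {y}) = measure \<mu> {x}" for x
    unfolding sum_distrib_left[symmetric] using assms by simp
  moreover have "(\<Sum>x\<in>spt \<mu>. measure \<mu> {x} * measure \<nu> {y}) = measure \<nu> {y}" for y
    unfolding sum_distrib_right[symmetric] using assms by simp
  ultimately show ?thesis
    by (simp add: transport_plans_def)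
qed

text \<open>
  Every term of a vanishing cost is zero, so the plan is concentrated on the diagonal. A point of
  one support carries mass that has to be sent to, or received from, a point of the other
  support, and that point can only be itself.
\<close>

lemma spt_eq_if_cost_zero:
  assumes fin: "finite (spt \<mu>)" "finite (spt \<nu>)"
    and \<gamma>: "\<gamma> \<in> transport_plans \<mu> \<nu>" "transport_cost \<mu> \<nu> \<gamma> = 0"
    and atoms: "\<And>x. x \<in> spt \<mu> \<Longrightarrow> measure \<mu> {x} \<noteq> 0" "\<And>y. y \<in> spt \<nu> \<Longrightarrow> measure \<nu> {y} \<noteq> 0"
  shows "spt \<mu> = spt \<nu>"
proof -
  have nonneg: "0 \<le> (norm (x - y))\<^sup>2 * \<gamma> x y" if "x \<in> spt \<mu>" "y \<in> spt \<nu>" for x y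
    using \<gamma>(1) that by (auto simp: transport_plans_def)
  have "(norm (x - y))\<^sup>2 * \<gamma> x y = 0" if "x \<in> spt \<mu>" "y \<in> spt \<nu>" for x y
  proof -
    have "(\<Sum>y\<in>spt \<nu>. (norm (x - y))\<^sup>2 * \<gamma> x y) = 0"
      using \<gamma>(2) that(1) fin nonneg unfolding transport_cost_def
      by (subst (asm) sum_nonneg_eq_0_iff) (auto intro!: sum_nonneg)
    then show ?thesis
      using that fin nonneg by (subst (asm) sum_nonneg_eq_0_iff) auto
  qed
  then have diag: "x = y" if "\<gamma> x y \<noteq> 0" "x \<in> spt \<mu>" "y \<in> spt \<nu>" for x y
    using that by fastforce
  have "x \<in> spt \<nu>" if x: "x \<in> spt \<mu>" for x
  proof -
    have "(\<Sum>y\<in>spt \<nu>. \<gamma> x y) \<noteq> 0"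
      using \<gamma>(1) x atoms(1) by (auto simp: transport_plans_def)
    then obtain y where "y \<in> spt \<nu>" "\<gamma> x y \<noteq> 0"
      by (meson sum.neutral)
    then show ?thesis
      using diag x by metis
  qed
  moreover have "y \<in> spt \<mu>" if y: "y \<in> spt \<nu>" for y
  proof -
    have "(\<Sum>x\<in>spt \<mu>. \<gamma> x y) \<noteq> 0"
      using \<gamma>(1) y atoms(2) by (auto simp: transport_plans_def)
    then obtain x where "x \<in> spt \<mu>" "\<gamma> x y \<noteq> 0"
      by (meson sum.neutral)
    then show ?thesis
      using diag y by metis
  qed
  ultimately show ?thesis
    by blast
qed

section \<open>Self-symmetry and vanishing transport cost\<close>

theorem W_partition_measure_eq_0_iff:
  fixes \<pi> \<rho> :: "('m::finite) array"
  assumes n: "n \<ge> 1" and \<pi>: "\<pi> \<in> partitions n" and \<rho>: "\<rho> \<in> partitions n"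
  shows "W (partition_measure n \<pi>) (partition_measure n \<rho>) = 0 \<longleftrightarrow> \<pi> = \<rho>"
proof -
  have spt: "spt (partition_measure n \<tau>) = cell_point ` cells \<tau>"
    and fin: "finite (spt (partition_measure n \<tau>))"
    and atom: "\<And>x. x \<in> spt (partition_measure n \<tau>) \<Longrightarrow> measure (partition_measure n \<tau>) {x} = 1 / real n"
    and mass: "(\<Sum>x\<in>spt (partition_measure n \<tau>). measure (partition_measure n \<tau>) {x}) = 1"
    if \<tau>: "\<tau> \<in> partitions n" for \<tau> :: "'m array"
  proof -
    have ind: "finite (indices \<tau>)"
      using \<tau> by (simp add: partitions_def)
    show spt: "spt (partition_measure n \<tau>) = cell_point ` cells \<tau>"
      by (rule spt_partition_measure[OF ind n])
    show "finite (spt (partition_measure n \<tau>))"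
      using spt finite_cells[OF ind] by simp
    show atom: "measure (partition_measure n \<tau>) {x} = 1 / real n"
      if "x \<in> spt (partition_measure n \<tau>)" for x
      using that unfolding spt by (rule measure_partition_measure_singleton[OF ind])
    have "card (spt (partition_measure n \<tau>)) = n"
      using spt is_diagram_cells(2)[OF \<tau>] by (simp add: card_image inj_on_subset[OF inj_cell_point])
    then show "(\<Sum>x\<in>spt (partition_measure n \<tau>). measure (partition_measure n \<tau>) {x}) = 1"
      using n atom by simp
  qed
  show ?thesis
  proof
    assume W0: "W (partition_measure n \<pi>) (partition_measure n \<rho>) = 0"
    obtain \<gamma> where \<gamma>: "\<gamma> \<in> transport_plans (partition_measure n \<pi>) (partition_measure n \<rho>)"
      "transport_cost (partition_measure n \<pi>) (partition_measure n \<rho>) \<gamma> = 0"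
    proof (rule W_attained[OF fin[OF \<pi>] fin[OF \<rho>]])
      show "transport_plans (partition_measure n \<pi>) (partition_measure n \<rho>) \<noteq> {}"
        using product_plan[OF mass[OF \<pi>] mass[OF \<rho>]] by blast
    qed (use W0 in simp)
    have "spt (partition_measure n \<pi>) = spt (partition_measure n \<rho>)"
      by (rule spt_eq_if_cost_zero[OF fin[OF \<pi>] fin[OF \<rho>] \<gamma>])
        (use n atom[OF \<pi>] atom[OF \<rho>] in auto)
    then have "cells \<pi> = cells \<rho>"
      by (simp add: spt[OF \<pi>] spt[OF \<rho>] inj_image_eq_iff[OF inj_cell_point])
    then show "\<pi> = \<rho>"
      by (rule cells_inject)
  next
    assume "\<pi> = \<rho>"
    then show "W (partition_measure n \<pi>) (partition_measure n \<rho>) = 0"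
      using W_self[OF fin[OF \<pi>]] by simp
  qed
qed

theorem theorem4p2:
  fixes n :: nat
    and \<sigma> :: "'m::finite option \<Rightarrow> 'm option"
    and \<pi> :: "'m array"
  assumes "n \<ge> 1"
    and "\<sigma> permutes UNIV"
    and "\<pi> \<in> partitions n"
  shows "self_symmetric n \<sigma> \<pi> \<longleftrightarrow>
    W (partition_measure n \<pi>) (partition_measure n (sym_partition n \<sigma> \<pi>)) = 0"
  using W_partition_measure_eq_0_iff[OF assms(1,3) sym_partition_in_partitions[OF assms(2,3)]]
  by (simp add: self_symmetric_def)

end
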